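(* Let $m\ge 3$, let $S:=B(-e_1,1)\cup B(e_1,1)\subset\mathbb{R}^m$, and let $\rho$ be the Borel measure $\rho:=\mathcal{H}^m\llcorner B(-e_1,1)+\mathcal{H}^m\llcorner B(e_1,1)$. Then, up to a set of zero Lebesgue measure, the partition $\{B(-e_1,1),B(e_1,1)\}$ of $S$ is the unique minimizer of the mean squared error. That is, $\mathcal{E}_S(S_1)\ge\mathcal{E}_S(B(-e_1,1))$ for every Borel-measurable $S_1\subset S$, with equality if and only if $S_1$ coincides, up to a set of zero Lebesgue measure, with $B(-e_1,1)$ or with $B(e_1,1)$.
   Context: $B(x,r)$ is the closed $m$-dimensional ball centered at $x$ with radius $r$; $e_1$ is the first standard basis vector of $\mathbb{R}^m$; $\mathcal{H}^m$ is the $m$-dimensional Hausdorff (i.e. Lebesgue) measure, and for a Borel set $A$, $(\mathcal{H}^m\llcorner A)(B)=\mathcal{H}^m(A\cap B)$ for every Borel set $B\subset\mathbb{R}^m$. Given a Borel measure $\rho$ on $\mathbb{R}^m$ with support $S$ and a Borel-measurable subset $S_1\subset S$ with complement $S_2=S\setminus S_1$, the mean squared error associated with the partition $\{S_1,S_2\}$ of $S$ is $$\mathcal{E}_S(S_1)=\min_{c\in\mathbb{R}^m}\int_{S_1}\|x-c\|^2\,d\rho(x)+\min_{d\in\mathbb{R}^m}\int_{S_2}\|x-d\|^2\,d\rho(x).$$ (The two closed balls share only the origin, a null set.) *)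

theory Defs
  imports "HOL-Analysis.Analysis"
begin

definition measure_plus :: "'a measure \<Rightarrow> 'a measure \<Rightarrow> 'a measure" where
  "measure_plus M N = measure_of (space M) (sets M) (\<lambda>A. emeasure M A + emeasure N A)"

text \<open>On \<open>real ^ 'n\<close> the Hausdorff measure of dimension \<open>CARD('n)\<close> is Lebesgue measure; \<open>lborel\<close>
  is its restriction to the Borel sets, and \<open>density lborel (indicator A)\<close> is its restriction
  \<open>B \<mapsto> lborel (A \<inter> B)\<close> to the Borel set \<open>A\<close>.\<close>

definition left_ball :: "'n::finite \<Rightarrow> (real ^ 'n) set" where
  "left_ball k = cball (- axis k 1) 1"

definition right_ball :: "'n::finite \<Rightarrow> (real ^ 'n) set" where
  "right_ball k = cball (axis k 1) 1"

definition two_balls :: "'n::finite \<Rightarrow> (real ^ 'n) set" where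
  "two_balls k = left_ball k \<union> right_ball k"

definition two_balls_measure :: "'n::finite \<Rightarrow> (real ^ 'n) measure" where
  "two_balls_measure k =
     measure_plus (density lborel (indicator (left_ball k)))
                  (density lborel (indicator (right_ball k)))"

text \<open>The mean squared error takes values in \<open>[0, \<infinity>]\<close>, so that it is meaningful for every Borel measure
  \<open>\<rho>\<close>. The infimum over the centres is a minimum as soon as \<open>\<rho>\<close> is finite and the set is
  bounded, see \<open>INF_cluster_error_attained\<close> below.\<close>

definition cluster_error :: "(real ^ 'n::finite) measure \<Rightarrow> (real ^ 'n) set \<Rightarrow> real ^ 'n \<Rightarrow> ennreal" where
  "cluster_error \<rho> A c = (\<integral>\<^sup>+ x \<in> A. ennreal ((norm (x - c))\<^sup>2) \<partial>\<rho>)"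

definition mean_squared_error ::
    "(real ^ 'n::finite) measure \<Rightarrow> (real ^ 'n) set \<Rightarrow> (real ^ 'n) set \<Rightarrow> ennreal" where
  "mean_squared_error \<rho> S S1 = (INF c. cluster_error \<rho> S1 c) + (INF d. cluster_error \<rho> (S - S1) d)"

lemma emeasure_measure_plus:
  assumes "sets N = sets M" and "A \<in> sets M"
  shows "emeasure (measure_plus M N) A = emeasure M A + emeasure N A"
proof (rule emeasure_measure_of[OF measure_plus_def])
  show "sets M \<subseteq> Pow (space M)" by (rule sets.space_closed)
  show "A \<in> sets (measure_plus M N)"
    using assms(2) by (simp add: measure_plus_def)
  have eq: "sets (measure_plus M N) = sets M"
    by (simp add: measure_plus_def)
  show "positive (sets (measure_plus M N)) (\<lambda>A. emeasure M A + emeasure N A)"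
    by (simp add: positive_def)
  show "countably_additive (sets (measure_plus M N)) (\<lambda>A. emeasure M A + emeasure N A)"
    unfolding eq countably_additive_def
    using assms(1) by (auto simp: suminf_add[symmetric] suminf_emeasure)
qed

lemma sets_two_balls_measure: "sets (two_balls_measure k) = sets borel"
  by (simp add: two_balls_measure_def measure_plus_def sets.sigma_sets_eq[of borel, simplified])

lemma emeasure_two_balls_measure:
  assumes "A \<in> sets borel"
  shows "emeasure (two_balls_measure k) A =
    emeasure lborel (left_ball k \<inter> A) + emeasure lborel (right_ball k \<inter> A)"
  using assms unfolding two_balls_measure_def
  by (subst emeasure_measure_plus) (auto simp: emeasure_restricted left_ball_def right_ball_def)

lemma finite_two_balls_measure:
  fixes k :: "'n::finite"
  shows "finite_measure (two_balls_measure k)"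
proof (rule finite_measureI)
  have sp: "space (two_balls_measure k) = UNIV"
    by (simp add: two_balls_measure_def measure_plus_def)
  show "emeasure (two_balls_measure k) (space (two_balls_measure k)) \<noteq> \<infinity>"
    unfolding sp
    using emeasure_lborel_cball_finite[of "axis k 1 :: real ^ 'n" 1]
      emeasure_lborel_cball_finite[of "- axis k 1 :: real ^ 'n" 1]
    by (subst emeasure_two_balls_measure) (simp_all add: left_ball_def right_ball_def less_top)
qed

lemma INF_cluster_error_attained:
  fixes \<rho> :: "(real ^ 'n::finite) measure"
  assumes fin: "finite_measure \<rho>" and bor: "sets \<rho> = sets borel"
    and A: "A \<in> sets borel" "bounded A"
  shows "\<exists>c. cluster_error \<rho> A c = (INF c. cluster_error \<rho> A c)"
proof -
  interpret finite_measure \<rho> by fact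
  have [measurable]: "A \<in> sets \<rho>" "A \<in> sets borel" using A bor by auto
  have [measurable_cong]: "sets \<rho> = sets borel" by fact
  define P where "P = (\<lambda>c. LINT x:A|\<rho>. (norm (x - c))\<^sup>2)"
  obtain r where r: "\<And>x. x \<in> A \<Longrightarrow> norm x \<le> r" using A(2) by (auto simp: bounded_iff)
  have int: "set_integrable \<rho> A f"
    if [measurable]: "f \<in> borel_measurable borel" and b: "\<And>x. x \<in> A \<Longrightarrow> norm (f x) \<le> B"
    for f :: "real ^ 'n \<Rightarrow> 'b::euclidean_space" and B
    unfolding set_integrable_def
    by (rule integrable_const_bound[where B = "\<bar>B\<bar>"])
       (use b in \<open>auto simp: indicator_def intro: order_trans[OF _ abs_ge_self]\<close>)
  have int2: "set_integrable \<rho> A (\<lambda>x. (norm (x - c))\<^sup>2)" for c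
  proof (rule int)
    fix x assume "x \<in> A"
    then have "norm (x - c) \<le> r + norm c"
      using r[of x] norm_triangle_ineq4[of x c] by linarith
    then show "norm ((norm (x - c))\<^sup>2) \<le> (r + norm c)\<^sup>2"
      by (simp add: power_mono)
  qed measurable
  have err: "cluster_error \<rho> A c = ennreal (P c)" for c
  proof -
    have "cluster_error \<rho> A c = (\<integral>\<^sup>+ x. ennreal (indicator A x *\<^sub>R (norm (x - c))\<^sup>2) \<partial>\<rho>)"
      unfolding cluster_error_def by (intro nn_integral_cong) (auto simp: indicator_def)
    also have "\<dots> = ennreal (P c)"
      unfolding P_def set_lebesgue_integral_def
      by (rule nn_integral_eq_integral) (use int2[of c] in \<open>auto simp: set_integrable_def\<close>)
    finally show ?thesis .
  qed
  define c0 where "c0 = (1 / measure \<rho> A) *\<^sub>R (LINT x:A|\<rho>. x)"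
  have min: "P c0 \<le> P c" for c
  proof (cases "measure \<rho> A = 0")
    case True
    then have nul: "A \<in> null_sets \<rho>" by (auto simp: null_sets_def emeasure_eq_measure)
    have "P d = 0" for d
      unfolding P_def set_lebesgue_integral_def
      by (rule integral_eq_zero_AE) (use AE_not_in[OF nul] in \<open>auto simp: indicator_def\<close>)
    then show ?thesis by simp
  next
    case False
    define v where "v = c0 - c"
    have i1: "set_integrable \<rho> A (\<lambda>x. x)" by (rule int) (use r in auto)
    have i0: "set_integrable \<rho> A (\<lambda>x. c0)" by (rule int[OF _ order_refl]) auto
    have i3: "set_integrable \<rho> A (\<lambda>x. x - c0)" by (rule set_integral_diff[OF i1 i0])
    have "(LINT x:A|\<rho>. x - c0) = (LINT x:A|\<rho>. x) - measure \<rho> A *\<^sub>R c0"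
      using i1 i0 by (simp add: set_integral_diff set_integral_const emeasure_eq_measure)
    also have "\<dots> = 0" using False by (simp add: c0_def)
    finally have z: "(LINT x:A|\<rho>. x - c0) = 0" .
    have sc: "indicator A x *\<^sub>R (2 * ((x - c0) \<bullet> v)) = (indicator A x *\<^sub>R (x - c0)) \<bullet> (2 *\<^sub>R v)" for x
      by (simp only: inner_scaleR_left inner_scaleR_right real_scaleR_def)
    have i4: "set_integrable \<rho> A (\<lambda>x. 2 * ((x - c0) \<bullet> v))"
      using i3 unfolding set_integrable_def sc by (rule integrable_inner_left)
    have "(LINT x:A|\<rho>. 2 * ((x - c0) \<bullet> v)) = (LINT x:A|\<rho>. x - c0) \<bullet> (2 *\<^sub>R v)"
      using i3 unfolding set_integrable_def set_lebesgue_integral_def sc by (intro integral_inner_left)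
    then have z4: "(LINT x:A|\<rho>. 2 * ((x - c0) \<bullet> v)) = 0"
      by (simp add: z)
    have "P c0 = (LINT x:A|\<rho>. (norm (x - c0))\<^sup>2 + 2 * ((x - c0) \<bullet> v))"
      using int2 i4 z4 by (simp add: P_def set_integral_add)
    also have "\<dots> \<le> P c"
      unfolding P_def
    proof (rule set_integral_mono)
      show "set_integrable \<rho> A (\<lambda>x. (norm (x - c0))\<^sup>2 + 2 * ((x - c0) \<bullet> v))"
        using int2 i4 by (rule set_integral_add)
      fix x assume "x \<in> A"
      have "(norm (x - c))\<^sup>2 = (norm ((x - c0) + v))\<^sup>2" by (simp add: v_def)
      also have "\<dots> = (norm (x - c0))\<^sup>2 + 2 * ((x - c0) \<bullet> v) + (norm v)\<^sup>2"
        by (simp only: power2_norm_eq_inner) (simp add: inner_add inner_commute)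
      finally show "(norm (x - c0))\<^sup>2 + 2 * ((x - c0) \<bullet> v) \<le> (norm (x - c))\<^sup>2" by simp
    qed (rule int2)
    finally show ?thesis .
  qed
  have "cluster_error \<rho> A c0 = (INF c. cluster_error \<rho> A c)"
    by (intro antisym INF_greatest INF_lower) (auto simp: err intro: ennreal_leI min)
  then show ?thesis ..
qed

end

theory Submission
  imports Defs
begin

text \<open>
  Fix the two centres \<open>c\<close> and \<open>d\<close> first. Whatever the partition, its error is at least the integral of
  \<open>min (|x - c|\<^sup>2) (|x - d|\<^sup>2)\<close> over both balls. Put \<open>a = (c + d) / 2\<close> and \<open>b = (c - d) / 2\<close>. The minimum
  equals \<open>|x - a|\<^sup>2 + |b|\<^sup>2 - 2 |b \<bullet> (x - a)|\<close>, so beating the partition into balls would require the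
  integral of \<open>|b \<bullet> (x - a)|\<close>, the weighted distance to the plane midway between the centres, to exceed
  \<open>V (1 + |a|\<^sup>2 + |b|\<^sup>2)\<close>, where \<open>V\<close> is the volume of one unit ball
  (\<open>midplane_distance_integral_le\<close>).

  With \<open>b = \<beta> u\<close> for a unit vector \<open>u\<close>, that integral involves each ball only through the mean of
  \<open>|x \<bullet> u - t|\<close> over the unit ball. Every chord of the unit ball in direction \<open>u\<close> projects to a segment
  \<open>[-r, r]\<close> with \<open>r \<le> 1\<close>. On such a segment the mean of \<open>|y - t|\<close> is largest for \<open>r = 1\<close>, since
  widening a symmetric segment increases the mean of a convex function. So the mean over
  \<open>[-1, 1]\<close>, called \<open>segment_bound t\<close>, bounds the mean over the ball (\<open>integral_ball_le\<close>). What remains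
  is a one-dimensional inequality: with \<open>\<alpha> = a \<bullet> u\<close> and \<open>s = e \<bullet> u\<close>, where \<open>e\<close> and \<open>- e\<close> are the
  centres of the balls, the sum of \<open>segment_bound\<close> at \<open>\<alpha> - s\<close> and \<open>\<alpha> + s\<close> is at most
  \<open>2 sqrt (1 + \<alpha>\<^sup>2)\<close>, and the arithmetic-geometric mean inequality absorbs \<open>\<beta>\<close>
  (\<open>sum_segment_bound_le\<close>, \<open>scaled_segment_bound_le\<close>).

  Equality forces \<open>\<alpha> = 0\<close>, \<open>|s| = 1\<close>, \<open>\<beta> = 1\<close> and \<open>a = 0\<close>, so \<open>c\<close> and \<open>d\<close> are the centres of the balls.
  Moreover almost every point must belong to the part whose centre is nearest to it. This determines
  the partition up to a null set, because the plane \<open>x \<bullet> e = 0\<close> separates the balls.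
\<close>

section \<open>Integration along parallel lines\<close>

lemma nn_integral_lborel_shift:
  fixes f :: "'a::euclidean_space \<Rightarrow> ennreal"
  assumes [measurable]: "f \<in> borel_measurable borel"
  shows "(\<integral>\<^sup>+x. f (p + x) \<partial>lborel) = (\<integral>\<^sup>+x. f x \<partial>lborel)"
  by (subst (2) lborel_distr_plus[of p, symmetric]) (simp add: nn_integral_distr)

text \<open>Fubini along the lines of direction \<open>u\<close>, obtained from translation invariance without choosing
  coordinates. Translating the integrand by \<open>s u\<close> does not change its integral, and the weight
  \<open>indicator {0..1} (x \<bullet> u - s)\<close> has total mass one in \<open>s\<close>. Inserting the weight and exchanging the
  integrals produces an average over the lines through the slab \<open>0 \<le> x \<bullet> u \<le> 1\<close>.\<close>

lemma nn_integral_line_slices: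
  fixes H :: "'a::euclidean_space \<Rightarrow> ennreal"
  assumes u: "norm u = 1" and [measurable]: "H \<in> borel_measurable borel"
  shows "(\<integral>\<^sup>+x. H x \<partial>lborel) =
    (\<integral>\<^sup>+x. indicator {0..1} (x \<bullet> u) * (\<integral>\<^sup>+s. H (x + s *\<^sub>R u) \<partial>lborel) \<partial>lborel)"
proof -
  \<comment> \<open>Shifted by \<open>s u\<close> along with the integrand, the weight \<open>W\<close> becomes \<open>indicator {0..1} (x \<bullet> u)\<close>.\<close>
  define W :: "'a \<Rightarrow> real \<Rightarrow> ennreal" where "W x s = indicator {0..1} (x \<bullet> u - s)" for x s
  have uu: "u \<bullet> u = 1"
    using u by (simp add: norm_eq_1)
  have [measurable]: "(\<lambda>p. W (fst p) (snd p)) \<in> borel_measurable (borel \<Otimes>\<^sub>M borel)"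
    unfolding W_def by measurable
  have W: "(\<integral>\<^sup>+s. W x s \<partial>lborel) = 1" for x
  proof -
    have "W x s = indicator {x \<bullet> u - 1..x \<bullet> u} s" for s
      by (auto simp: W_def indicator_def)
    then show ?thesis by simp
  qed
  have "(\<integral>\<^sup>+x. indicator {0..1} (x \<bullet> u) * (\<integral>\<^sup>+s. H (x + s *\<^sub>R u) \<partial>lborel) \<partial>lborel)
      = (\<integral>\<^sup>+x. \<integral>\<^sup>+s. W (x + s *\<^sub>R u) s * H (x + s *\<^sub>R u) \<partial>lborel \<partial>lborel)"
    by (simp add: W_def inner_add_left uu nn_integral_cmult)
  also have "\<dots> = (\<integral>\<^sup>+s. \<integral>\<^sup>+x. W (x + s *\<^sub>R u) s * H (x + s *\<^sub>R u) \<partial>lborel \<partial>lborel)"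
    unfolding W_def by (rule lborel_pair.Fubini'[symmetric]) measurable
  also have "\<dots> = (\<integral>\<^sup>+s. \<integral>\<^sup>+x. W x s * H x \<partial>lborel \<partial>lborel)"
  proof (rule nn_integral_cong)
    fix s :: real
    have "(\<lambda>x. W x s * H x) \<in> borel_measurable borel"
      unfolding W_def by measurable
    from nn_integral_lborel_shift[OF this, of "s *\<^sub>R u"]
    show "(\<integral>\<^sup>+x. W (x + s *\<^sub>R u) s * H (x + s *\<^sub>R u) \<partial>lborel) = (\<integral>\<^sup>+x. W x s * H x \<partial>lborel)"
      by (simp add: add.commute)
  qed
  also have "\<dots> = (\<integral>\<^sup>+x. \<integral>\<^sup>+s. W x s * H x \<partial>lborel \<partial>lborel)"
    unfolding W_def by (rule lborel_pair.Fubini') measurable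
  also have "\<dots> = (\<integral>\<^sup>+x. H x \<partial>lborel)"
  proof (rule nn_integral_cong)
    fix x
    have "(\<lambda>s. W x s) \<in> borel_measurable lborel"
      unfolding W_def by measurable
    then show "(\<integral>\<^sup>+s. W x s * H x \<partial>lborel) = H x"
      by (subst nn_integral_multc) (simp_all add: W)
  qed
  finally show ?thesis by simp
qed

section \<open>Mean distance to a plane over the unit ball\<close>

text \<open>The mean of \<open>\<bar>y - t\<bar>\<close> for \<open>y\<close> uniform on \<open>[-1, 1]\<close>.\<close>

definition segment_bound :: "real \<Rightarrow> real" where
  "segment_bound t = (if \<bar>t\<bar> \<le> 1 then (1 + t\<^sup>2) / 2 else \<bar>t\<bar>)"

lemma segment_bound_nonneg: "0 \<le> segment_bound t"
  by (simp add: segment_bound_def)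

lemma segment_bound_minus: "segment_bound (- t) = segment_bound t"
  by (simp add: segment_bound_def)

text \<open>The left-hand side is twice the integral of \<open>\<bar>y - t\<bar>\<close> over \<open>[-r, r]\<close>. If \<open>t\<close> lies in the
  segment, the claim reduces to \<open>0 \<le> (1 - r) (r - t\<^sup>2)\<close>; otherwise the mean over the segment is \<open>\<bar>t\<bar>\<close>.\<close>

lemma segment_distance_le:
  assumes r: "0 \<le> r" "r \<le> 1"
  shows "(r - t) * \<bar>r - t\<bar> + (r + t) * \<bar>r + t\<bar> \<le> 4 * r * segment_bound t"
proof -
  consider "\<bar>t\<bar> \<le> r" | "r < \<bar>t\<bar>" "\<bar>t\<bar> \<le> 1" | "1 < \<bar>t\<bar>" by linarith
  then show ?thesis
  proof cases
    case 1
    have "t\<^sup>2 \<le> r\<^sup>2" using 1 by (simp add: abs_le_square_iff[symmetric])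
    also have "r\<^sup>2 \<le> r" using r by (simp add: power2_eq_square mult_left_le)
    finally have "0 \<le> (1 - r) * (r - t\<^sup>2)" using r by simp
    then have "2 * (r\<^sup>2 + t\<^sup>2) \<le> 2 * r * (1 + t\<^sup>2)"
      by (simp add: algebra_simps power2_eq_square)
    moreover have "(r - t) * \<bar>r - t\<bar> + (r + t) * \<bar>r + t\<bar> = 2 * (r\<^sup>2 + t\<^sup>2)"
      using 1 by (simp add: algebra_simps power2_eq_square)
    ultimately show ?thesis using 1 r by (simp add: segment_bound_def)
  next
    case 2
    have "(r - t) * \<bar>r - t\<bar> + (r + t) * \<bar>r + t\<bar> = 4 * r * \<bar>t\<bar>"
      using 2 r by (cases "0 \<le> t") (simp_all add: algebra_simps)
    also have "\<dots> \<le> 4 * r * ((1 + t\<^sup>2) / 2)"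
    proof (rule mult_left_mono)
      have "0 \<le> (1 - \<bar>t\<bar>)\<^sup>2" by simp
      then show "\<bar>t\<bar> \<le> (1 + t\<^sup>2) / 2" by (simp add: power2_diff)
    qed (use r in simp)
    finally show ?thesis using 2 by (simp add: segment_bound_def)
  next
    case 3
    then have "(r - t) * \<bar>r - t\<bar> + (r + t) * \<bar>r + t\<bar> = 4 * r * \<bar>t\<bar>"
      using r by (cases "0 \<le> t") (simp_all add: algebra_simps)
    then show ?thesis using 3 by (simp add: segment_bound_def)
  qed
qed

lemma DERIV_half_signed_square: "((\<lambda>y. y * \<bar>y\<bar> / 2) has_real_derivative \<bar>y\<bar>) (at y)"
proof -
  consider "0 < y" | "y < 0" | "y = 0" by linarith
  then show ?thesis
  proof cases
    case 1
    have "((\<lambda>y. y * y / 2) has_real_derivative \<bar>y\<bar>) (at y)"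
      using 1 by (auto intro!: derivative_eq_intros)
    then show ?thesis
      by (rule has_field_derivative_transform_within_open[of _ _ _ "{0<..}"]) (use 1 in auto)
  next
    case 2
    have "((\<lambda>y. - (y * y / 2)) has_real_derivative \<bar>y\<bar>) (at y)"
      using 2 by (auto intro!: derivative_eq_intros)
    then show ?thesis
      by (rule has_field_derivative_transform_within_open[of _ _ _ "{..<0}"]) (use 2 in auto)
  next
    case 3
    have "((\<lambda>h::real. \<bar>h\<bar> / 2) \<longlongrightarrow> 0) (at 0)"
      by (intro tendsto_eq_intros) auto
    then have "((\<lambda>h::real. (h * \<bar>h\<bar> / 2) / h) \<longlongrightarrow> 0) (at 0)"
      by (rule Lim_transform_eventually) (auto simp: eventually_at_filter)
    then show ?thesis using 3 by (simp add: DERIV_def)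
  qed
qed

text \<open>The mean over \<open>[-r, r]\<close> does not exceed the mean over \<open>[-1, 1]\<close>. Both sides are written as integrals
  over the segment so that they can be integrated over all chords of the ball.\<close>

lemma nn_integral_segment_le:
  assumes r: "0 \<le> r" "r \<le> 1"
  shows "(\<integral>\<^sup>+y\<in>{-r..r}. ennreal \<bar>y - t\<bar> \<partial>lborel)
    \<le> (\<integral>\<^sup>+y\<in>{-r..r}. ennreal (segment_bound t) \<partial>lborel)"
proof -
  \<comment> \<open>An antiderivative of \<open>\<bar>y - t\<bar>\<close> that needs no case distinction at \<open>y = t\<close>.\<close>
  define F where "F y = (y - t) * \<bar>y - t\<bar> / 2" for y :: real
  have F: "(F has_real_derivative \<bar>y - t\<bar>) (at y)" for y
    using DERIV_half_signed_square[of "y - t"] DERIV_shift[of "\<lambda>y. y * \<bar>y\<bar> / 2" "\<bar>y - t\<bar>" y "- t"]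
    unfolding F_def by simp
  have "(\<integral>\<^sup>+y\<in>{-r..r}. ennreal \<bar>y - t\<bar> \<partial>lborel) = ennreal (F r - F (- r))"
    using r F by (intro nn_integral_FTC_Icc) auto
  also have "\<dots> \<le> ennreal (segment_bound t * (2 * r))"
  proof (rule ennreal_leI)
    have "- r - t = - (r + t)" by simp
    then have "(- r - t) * \<bar>- r - t\<bar> = - ((r + t) * \<bar>r + t\<bar>)"
      by (simp only: abs_minus_cancel mult_minus_left)
    then have "F r - F (- r) = ((r - t) * \<bar>r - t\<bar> + (r + t) * \<bar>r + t\<bar>) / 2"
      by (simp add: F_def)
    then show "F r - F (- r) \<le> segment_bound t * (2 * r)"
      using segment_distance_le[OF r, of t] by (simp add: mult_ac)
  qed
  also have "\<dots> = (\<integral>\<^sup>+y\<in>{-r..r}. ennreal (segment_bound t) \<partial>lborel)"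
    using r by (simp add: nn_integral_cmult ennreal_mult segment_bound_nonneg)
  finally show ?thesis .
qed

lemma ball_slice:
  fixes u x :: "'a::euclidean_space"
  assumes u: "norm u = 1"
  obtains r where "0 \<le> r" "r \<le> 1"
    and "\<And>s. x + s *\<^sub>R u \<in> cball 0 1 \<longleftrightarrow> x \<bullet> u + s \<in> {-r..r}"
  | "\<And>s. x + s *\<^sub>R u \<notin> cball 0 1"
proof -
  \<comment> \<open>The component of \<open>x\<close> orthogonal to \<open>u\<close>; by Pythagoras a nonempty chord has half-length \<open>sqrt (1 - |w|\<^sup>2)\<close>.\<close>
  define w where "w = x - (x \<bullet> u) *\<^sub>R u"
  define q where "q = 1 - (norm w)\<^sup>2"
  have uu: "u \<bullet> u = 1" using u by (simp add: norm_eq_1)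
  have mem: "x + s *\<^sub>R u \<in> cball 0 1 \<longleftrightarrow> (x \<bullet> u + s)\<^sup>2 \<le> q" for s
  proof -
    have wu: "w \<bullet> u = 0" by (simp add: w_def inner_diff_left uu)
    have "x + s *\<^sub>R u = w + (x \<bullet> u + s) *\<^sub>R u" by (simp add: w_def algebra_simps)
    then have "(norm (x + s *\<^sub>R u))\<^sup>2 = (norm w)\<^sup>2 + (x \<bullet> u + s)\<^sup>2"
      by (simp add: norm_add_Pythagorean orthogonal_def wu u power_mult_distrib)
    moreover have "x + s *\<^sub>R u \<in> cball 0 1 \<longleftrightarrow> (norm (x + s *\<^sub>R u))\<^sup>2 \<le> 1"
      by (simp add: power_le_one_iff)
    ultimately show ?thesis by (auto simp: q_def)
  qed
  show ?thesis
  proof (cases "0 \<le> q")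
    case True
    show ?thesis
    proof (rule that(1))
      show "0 \<le> sqrt q" "sqrt q \<le> 1" using True by (simp_all add: q_def)
      show "x + s *\<^sub>R u \<in> cball 0 1 \<longleftrightarrow> x \<bullet> u + s \<in> {- sqrt q..sqrt q}" for s
        unfolding mem real_sqrt_le_iff[of "(x \<bullet> u + s)\<^sup>2" q, symmetric] real_sqrt_abs
        by auto
    qed
  next
    case False
    then have "\<not> (x \<bullet> u + s)\<^sup>2 \<le> q" for s
      using zero_le_power2[of "x \<bullet> u + s"] by linarith
    then show ?thesis
      using that(2) mem by blast
  qed
qed

text \<open>The inequality holds on each chord in direction \<open>u\<close>, hence after integrating over all chords.\<close>

lemma nn_integral_ball_le:
  fixes u :: "'a::euclidean_space"
  assumes u: "norm u = 1"
  shows "(\<integral>\<^sup>+x\<in>cball 0 1. ennreal \<bar>x \<bullet> u - t\<bar> \<partial>lborel)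
    \<le> (\<integral>\<^sup>+x\<in>cball (0::'a) 1. ennreal (segment_bound t) \<partial>lborel)"
proof -
  have uu: "u \<bullet> u = 1" using u by (simp add: norm_eq_1)
  have line: "(\<integral>\<^sup>+s. ennreal \<bar>(x + s *\<^sub>R u) \<bullet> u - t\<bar> * indicator (cball 0 1) (x + s *\<^sub>R u) \<partial>lborel)
    \<le> (\<integral>\<^sup>+s. ennreal (segment_bound t) * indicator (cball 0 1) (x + s *\<^sub>R u) \<partial>lborel)" for x
  proof (cases rule: ball_slice[OF u, of x])
    case (1 r)
    have ind: "indicator (cball 0 1) (x + s *\<^sub>R u) = (indicator {-r..r} (x \<bullet> u + s) :: ennreal)" for s
      using 1(3)[of s] by (simp add: indicator_def del: mem_cball)
    have "(\<integral>\<^sup>+s. ennreal \<bar>x \<bullet> u + s - t\<bar> * indicator {-r..r} (x \<bullet> u + s) \<partial>lborel)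
        \<le> (\<integral>\<^sup>+s. ennreal (segment_bound t) * indicator {-r..r} (x \<bullet> u + s) \<partial>lborel)"
      using nn_integral_segment_le[OF 1(1,2), of t]
        nn_integral_lborel_shift[of "\<lambda>y. ennreal \<bar>y - t\<bar> * indicator {-r..r} y" "x \<bullet> u"]
        nn_integral_lborel_shift[of "\<lambda>y. ennreal (segment_bound t) * indicator {-r..r} y" "x \<bullet> u"]
      by simp
    then show ?thesis
      by (simp add: ind inner_add_left uu)
  next
    case 2
    then show ?thesis by (simp add: indicator_def del: mem_cball)
  qed
  have [measurable]: "(\<lambda>x. ennreal \<bar>x \<bullet> u - t\<bar> * indicator (cball 0 1) x) \<in> borel_measurable borel"
    "(\<lambda>x::'a. ennreal (segment_bound t) * indicator (cball 0 1) x) \<in> borel_measurable borel"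
    by (auto intro!: borel_measurable_times_ennreal borel_measurable_indicator)
  show ?thesis
    by (subst (1 2) nn_integral_line_slices[OF u]) (auto intro!: nn_integral_mono mult_left_mono line)
qed

section \<open>The one-dimensional inequality\<close>

text \<open>By symmetry \<open>\<alpha>\<close> and \<open>s\<close> may be taken nonnegative. The sum is convex and even in \<open>s\<close>, so it is largest
  at \<open>s = 1\<close>. For \<open>0 \<le> \<alpha> \<le> 2\<close> it is then \<open>2 + \<alpha>\<^sup>2 / 2\<close>, whose square is at most \<open>4 (1 + \<alpha>\<^sup>2)\<close> because
  \<open>\<alpha>\<^sup>2 \<le> 8\<close>, with equality only for \<open>\<alpha> = 0\<close>; for larger \<open>\<alpha>\<close> it is \<open>2 \<alpha>\<close>. The three cases of the proof follow the positions of
  \<open>\<alpha> - s\<close> and \<open>\<alpha> + s\<close> relative to \<open>1\<close>.\<close>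

lemma sum_segment_bound_le:
  assumes s: "\<bar>s\<bar> \<le> 1"
  shows "(segment_bound (\<alpha> - s) + segment_bound (\<alpha> + s))\<^sup>2 \<le> 4 * (1 + \<alpha>\<^sup>2)"
    and "(segment_bound (\<alpha> - s) + segment_bound (\<alpha> + s))\<^sup>2 = 4 * (1 + \<alpha>\<^sup>2) \<Longrightarrow> \<alpha> = 0 \<and> \<bar>s\<bar> = 1"
proof -
  define Q where "Q \<alpha> s = segment_bound (\<alpha> - s) + segment_bound (\<alpha> + s)" for \<alpha> s
  have main: "(Q \<alpha> s)\<^sup>2 \<le> 4 * (1 + \<alpha>\<^sup>2) \<and> ((Q \<alpha> s)\<^sup>2 = 4 * (1 + \<alpha>\<^sup>2) \<longrightarrow> \<alpha> = 0 \<and> s = 1)"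
    if "0 \<le> \<alpha>" "0 \<le> s" "s \<le> 1" for \<alpha> s :: real
  proof -
    have Q0: "0 \<le> Q \<alpha> s" by (simp add: Q_def segment_bound_nonneg)
    consider "\<alpha> + s \<le> 1" | "1 < \<alpha> + s" "\<alpha> - s \<le> 1" | "1 < \<alpha> - s" by linarith
    then show ?thesis
    proof cases
      case 1
      have Q: "Q \<alpha> s = 1 + \<alpha>\<^sup>2 + s\<^sup>2"
      proof -
        have "\<bar>\<alpha> - s\<bar> \<le> 1" "\<bar>\<alpha> + s\<bar> \<le> 1" using 1 that by linarith+
        then show ?thesis
          unfolding Q_def segment_bound_def by (simp add: power2_eq_square field_simps)
      qed
      have "\<alpha>\<^sup>2 \<le> \<alpha>" "s\<^sup>2 \<le> s"
        using 1 that by (simp_all add: power2_eq_square mult_left_le)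
      then have "Q \<alpha> s \<le> 2" using 1 Q by linarith
      then have "(Q \<alpha> s)\<^sup>2 \<le> 2\<^sup>2" using Q0 by (rule power_mono)
      moreover have "\<alpha> = 0 \<and> s = 1" if "(Q \<alpha> s)\<^sup>2 = 4 * (1 + \<alpha>\<^sup>2)"
      proof -
        have "\<alpha> = 0" using \<open>(Q \<alpha> s)\<^sup>2 \<le> 2\<^sup>2\<close> that by simp
        moreover have "s = 1" if "\<alpha> = 0"
        proof -
          have "(Q \<alpha> s)\<^sup>2 = 2\<^sup>2" using \<open>(Q \<alpha> s)\<^sup>2 = 4 * (1 + \<alpha>\<^sup>2)\<close> that by simp
          then have "Q \<alpha> s = 2" using Q0 by (simp only: power2_eq_iff_nonneg)
          then show ?thesis using Q that \<open>0 \<le> s\<close> by (simp add: power2_eq_1_iff)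
        qed
        ultimately show ?thesis by blast
      qed
      ultimately show ?thesis by (simp add: add_increasing2)
    next
      case 2
      then have "0 < \<alpha>" using that by linarith
      have "Q \<alpha> s = \<alpha> + s + (1 + (\<alpha> - s)\<^sup>2) / 2"
      proof -
        have "\<bar>\<alpha> - s\<bar> \<le> 1" "\<not> \<bar>\<alpha> + s\<bar> \<le> 1" "\<bar>\<alpha> + s\<bar> = \<alpha> + s" using 2 that by linarith+
        then show ?thesis
          unfolding Q_def segment_bound_def by simp
      qed
      also have "\<dots> \<le> 2 + \<alpha>\<^sup>2 / 2"
      proof -
        \<comment> \<open>The expression is increasing in \<open>s\<close> up to \<open>s = 1\<close>, where it equals the right-hand side.\<close>
        have "0 \<le> (1 - s) * (3 - 2 * \<alpha> + s)"
          using 2 that by (intro mult_nonneg_nonneg) linarith+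
        then show ?thesis by (simp add: power2_eq_square field_simps)
      qed
      finally have "(Q \<alpha> s)\<^sup>2 \<le> (2 + \<alpha>\<^sup>2 / 2)\<^sup>2" using Q0 by (rule power_mono)
      also have "\<dots> < 4 * (1 + \<alpha>\<^sup>2)"
      proof -
        define y where "y = \<alpha>\<^sup>2"
        have "y \<le> 2\<^sup>2" unfolding y_def using 2 that by (intro power_mono) linarith+
        moreover have "0 < y" using \<open>0 < \<alpha>\<close> by (simp add: y_def)
        ultimately have "0 < y * (8 - y)" by (intro mult_pos_pos) auto
        then show ?thesis
          unfolding y_def[symmetric] by (simp add: power2_eq_square field_simps)
      qed
      finally show ?thesis by simp
    next
      case 3
      then have "Q \<alpha> s = 2 * \<alpha>" using that by (simp add: Q_def segment_bound_def)
      then show ?thesis by (simp add: power_mult_distrib)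
    qed
  qed
  have "Q \<alpha> s = Q \<bar>\<alpha>\<bar> \<bar>s\<bar>"
    using segment_bound_minus[of "\<alpha> - s"] segment_bound_minus[of "\<alpha> + s"]
    by (cases "0 \<le> \<alpha>"; cases "0 \<le> s") (simp_all add: Q_def add.commute)
  with main[of "\<bar>\<alpha>\<bar>" "\<bar>s\<bar>"] s
  show "(segment_bound (\<alpha> - s) + segment_bound (\<alpha> + s))\<^sup>2 \<le> 4 * (1 + \<alpha>\<^sup>2)"
    and "(segment_bound (\<alpha> - s) + segment_bound (\<alpha> + s))\<^sup>2 = 4 * (1 + \<alpha>\<^sup>2) \<Longrightarrow> \<alpha> = 0 \<and> \<bar>s\<bar> = 1"
    by (auto simp: Q_def)
qed

text \<open>This is \<open>\<beta> Q \<le> \<beta>\<^sup>2 + Q\<^sup>2 / 4\<close> combined with the bound on \<open>Q\<^sup>2\<close>.\<close>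

lemma scaled_segment_bound_le:
  fixes \<alpha> \<beta> s :: real
  assumes s: "\<bar>s\<bar> \<le> 1"
  defines "Q \<equiv> segment_bound (\<alpha> - s) + segment_bound (\<alpha> + s)"
  shows "\<beta> * Q \<le> 1 + \<alpha>\<^sup>2 + \<beta>\<^sup>2"
    and "\<lbrakk>\<beta> * Q = 1 + \<alpha>\<^sup>2 + \<beta>\<^sup>2; 0 \<le> \<beta>\<rbrakk> \<Longrightarrow> \<alpha> = 0 \<and> \<bar>s\<bar> = 1 \<and> \<beta> = 1"
proof -
  have sq: "(\<beta> - Q / 2)\<^sup>2 = \<beta>\<^sup>2 - \<beta> * Q + Q\<^sup>2 / 4"
    by (simp add: power2_eq_square field_simps)
  note Q = sum_segment_bound_le[OF s, of \<alpha>, folded Q_def]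
  have sq0: "0 \<le> (\<beta> - Q / 2)\<^sup>2" by simp
  show "\<beta> * Q \<le> 1 + \<alpha>\<^sup>2 + \<beta>\<^sup>2" using sq sq0 Q(1) by argo
  assume eq: "\<beta> * Q = 1 + \<alpha>\<^sup>2 + \<beta>\<^sup>2" and "0 \<le> \<beta>"
  then have "Q\<^sup>2 = 4 * (1 + \<alpha>\<^sup>2)" using sq sq0 Q(1) by argo
  then have *: "\<alpha> = 0" "\<bar>s\<bar> = 1" using Q(2) by auto
  have "s = 1 \<or> s = - 1" using *(2) by linarith
  then have "Q = 2" using *(1) by (auto simp: Q_def segment_bound_def)
  with eq *(1) have "(\<beta> - 1)\<^sup>2 = 0" by (simp add: power2_diff)
  with * show "\<alpha> = 0 \<and> \<bar>s\<bar> = 1 \<and> \<beta> = 1" by simp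
qed

section \<open>Integrals over balls\<close>

lemma set_nn_integral_eq_set_integral:
  fixes f :: "'a \<Rightarrow> real"
  assumes "set_integrable M A f" and "\<And>x. x \<in> A \<Longrightarrow> 0 \<le> f x"
  shows "(\<integral>\<^sup>+x\<in>A. ennreal (f x) \<partial>M) = ennreal (LINT x:A|M. f x)"
proof -
  have "(\<integral>\<^sup>+x\<in>A. ennreal (f x) \<partial>M) = (\<integral>\<^sup>+x. ennreal (indicator A x *\<^sub>R f x) \<partial>M)"
    by (intro nn_integral_cong) (auto simp: indicator_def)
  also have "\<dots> = ennreal (LINT x:A|M. f x)"
    unfolding set_lebesgue_integral_def
    using assms by (intro nn_integral_eq_integral) (auto simp: set_integrable_def indicator_def)
  finally show ?thesis .
qed

lemma set_integral_eq_imp_AE_eq: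
  fixes f g :: "'a \<Rightarrow> real"
  assumes "set_integrable M A f" "set_integrable M A g"
    and "\<And>x. x \<in> A \<Longrightarrow> f x \<le> g x"
    and "(LINT x:A|M. f x) = (LINT x:A|M. g x)"
  shows "AE x\<in>A in M. f x = g x"
proof -
  have "AE x in M. indicator A x *\<^sub>R f x = indicator A x *\<^sub>R g x"
    using assms unfolding set_integrable_def set_lebesgue_integral_def
    by (intro integral_ineq_eq_0_then_AE) (auto simp: indicator_def)
  then show ?thesis by eventually_elim (auto simp: indicator_def)
qed

lemma set_integrable_lborel_compact:
  fixes f :: "'a::euclidean_space \<Rightarrow> real"
  assumes "compact K" "A \<in> sets borel" "A \<subseteq> K" "continuous_on UNIV f"
  shows "set_integrable lborel A f"
proof (rule set_integrable_subset)
  show "set_integrable lborel K f"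
    unfolding set_integrable_def
    using assms by (intro borel_integrable_compact) (auto intro: continuous_on_subset)
qed (use assms in auto)

lemma set_integrable_lborel_cball:
  fixes f :: "'a::euclidean_space \<Rightarrow> real"
  assumes "continuous_on UNIV f"
  shows "set_integrable lborel (cball p r) f"
  using assms by (rule set_integrable_lborel_compact[OF compact_cball _ order_refl, rotated]) simp

lemma measure_unit_ball_pos: "0 < measure lborel (cball (0::'a::euclidean_space) 1)"
  using content_cball_pos[of 1 "0::'a"] by simp

lemma set_integral_const_unit_ball:
  "(LINT x:cball (0::'a::euclidean_space) 1|lborel. c) = c * measure lborel (cball (0::'a) 1)"
  using emeasure_lborel_cball_finite[of "0::'a" 1] by (simp add: set_integral_const less_top)

lemma integral_ball_le:
  fixes u :: "'a::euclidean_space"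
  assumes u: "norm u = 1"
  shows "(LINT x:cball 0 1|lborel. \<bar>x \<bullet> u - t\<bar>)
    \<le> segment_bound t * measure lborel (cball (0::'a) 1)"
proof -
  have "ennreal (LINT x:cball 0 1|lborel. \<bar>x \<bullet> u - t\<bar>)
      \<le> ennreal (LINT x:cball (0::'a) 1|lborel. segment_bound t)"
    using nn_integral_ball_le[OF u, of t]
    by (subst (1 2) set_nn_integral_eq_set_integral[symmetric])
       (auto intro!: set_integrable_lborel_cball continuous_intros simp: segment_bound_nonneg)
  then show ?thesis
    by (simp add: ennreal_le_iff segment_bound_nonneg set_integral_const_unit_ball)
qed

lemma set_integral_cball_shift:
  fixes f :: "'a::euclidean_space \<Rightarrow> real"
  assumes [measurable]: "f \<in> borel_measurable borel"
  shows "(LINT x:cball p r|lborel. f x) = (LINT x:cball 0 r|lborel. f (p + x))"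
proof -
  have "(LINT x:cball p r|lborel. f x) = (LINT x|distr lborel borel ((+) p). indicator (cball p r) x *\<^sub>R f x)"
    by (simp add: set_lebesgue_integral_def lborel_distr_plus)
  also have "\<dots> = (LINT x:cball 0 r|lborel. f (p + x))"
  proof -
    have "indicator (cball p r) (p + x) = (indicator (cball 0 r) x :: real)" for x
      by (auto simp: indicator_def dist_norm)
    moreover have [measurable]: "cball p r \<in> sets borel" by simp
    moreover have "(\<lambda>x. indicator (cball p r) x *\<^sub>R f x) \<in> borel_measurable borel" by measurable
    ultimately show ?thesis
      by (subst integral_distr) (simp_all add: set_lebesgue_integral_def)
  qed
  finally show ?thesis .
qed

text \<open>The ball is invariant under \<open>x \<mapsto> - x\<close>, and the integrand is odd.\<close>

lemma set_integral_unit_ball_inner: "(LINT x:cball 0 1|lborel. x \<bullet> a) = 0" for a :: "'a::euclidean_space"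
proof -
  let ?f = "\<lambda>x. indicator (cball 0 1) x *\<^sub>R (x \<bullet> a)"
  have *: "lborel = distr lborel borel (\<lambda>x::'a. - x)"
    using lborel_affine[of "- 1" "0::'a"] by (simp add: density_1)
  have [measurable]: "cball (0::'a) 1 \<in> sets borel" by simp
  have "?f \<in> borel_measurable borel" by measurable
  have "(LINT x|lborel. ?f x) = (LINT x|distr lborel borel (\<lambda>x::'a. - x). ?f x)"
    using * by simp
  also have "\<dots> = (LINT x|lborel. ?f (- x))"
    by (rule integral_distr) (use \<open>?f \<in> borel_measurable borel\<close> in simp_all)
  also have "\<dots> = - (LINT x|lborel. ?f x)"
    by (simp add: indicator_def flip: integral_minus)
  finally show ?thesis by (simp add: set_lebesgue_integral_def)
qed

section \<open>Two centres for two tangent balls\<close>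

text \<open>The integral is the weighted distance \<open>\<bar>b \<bullet> (y - a)\<bar>\<close> integrated over both balls, after translating
  each to the origin. For \<open>b = \<beta> u\<close> the translates have offsets \<open>\<alpha> - s\<close> and \<open>\<alpha> + s\<close>, and the
  one-dimensional inequality gives \<open>V (1 + \<alpha>\<^sup>2 + \<beta>\<^sup>2)\<close>. Replacing \<open>\<alpha> = a \<bullet> u\<close> by \<open>|a|\<close> is the
  Cauchy-Schwarz inequality. Equality has to hold in each step, which leaves only \<open>a = 0\<close> and
  \<open>u = \<plusminus> e\<close>.\<close>

lemma midplane_distance_integral_le:
  fixes e a b :: "'a::euclidean_space"
  assumes e: "norm e = 1"
  defines "I \<equiv> (LINT x:cball 0 1|lborel. \<bar>b \<bullet> (e + x - a)\<bar> + \<bar>b \<bullet> (- e + x - a)\<bar>)"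
    and "V \<equiv> measure lborel (cball (0::'a) 1)"
  shows "I \<le> V * (1 + (norm a)\<^sup>2 + (norm b)\<^sup>2)"
    and "I = V * (1 + (norm a)\<^sup>2 + (norm b)\<^sup>2) \<Longrightarrow> a = 0 \<and> (b = e \<or> b = - e)"
proof -
  have V: "0 < V" unfolding V_def by (rule measure_unit_ball_pos)
  have "I \<le> V * (1 + (norm a)\<^sup>2 + (norm b)\<^sup>2) \<and>
    (I = V * (1 + (norm a)\<^sup>2 + (norm b)\<^sup>2) \<longrightarrow> a = 0 \<and> (b = e \<or> b = - e))"
  proof (cases "b = 0")
    case True
    then have "I = 0" by (simp add: I_def)
    moreover have "0 < V * (1 + (norm a)\<^sup>2 + (norm b)\<^sup>2)"
      using V by (intro mult_pos_pos add_pos_nonneg) auto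
    ultimately show ?thesis by auto
  next
    case False
    define \<beta> where "\<beta> = norm b"
    define u where "u = b /\<^sub>R \<beta>"
    define \<alpha> where "\<alpha> = a \<bullet> u"
    define s where "s = e \<bullet> u"
    define Q where "Q = segment_bound (\<alpha> - s) + segment_bound (\<alpha> + s)"
    have \<beta>: "0 < \<beta>" using False by (simp add: \<beta>_def)
    have u: "norm u = 1" and b: "b = \<beta> *\<^sub>R u"
      using \<beta> by (simp_all add: u_def \<beta>_def)
    have s: "\<bar>s\<bar> \<le> 1"
      using Cauchy_Schwarz_ineq2[of e u] by (simp add: s_def e u)
    have int: "set_integrable lborel (cball 0 1) (\<lambda>x. \<beta> * \<bar>x \<bullet> u - t\<bar>)" for t
      by (intro set_integrable_lborel_cball continuous_intros)
    have "b \<bullet> (e + x - a) = \<beta> * (x \<bullet> u - (\<alpha> - s))"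
      and "b \<bullet> (- e + x - a) = \<beta> * (x \<bullet> u - (\<alpha> + s))" for x
      by (simp_all add: b s_def \<alpha>_def inner_simps inner_commute algebra_simps)
    then have "\<bar>b \<bullet> (e + x - a)\<bar> = \<beta> * \<bar>x \<bullet> u - (\<alpha> - s)\<bar>"
      and "\<bar>b \<bullet> (- e + x - a)\<bar> = \<beta> * \<bar>x \<bullet> u - (\<alpha> + s)\<bar>" for x
      using \<beta> by (simp_all only: abs_mult abs_of_pos)
    then have "I = \<beta> * (LINT x:cball 0 1|lborel. \<bar>x \<bullet> u - (\<alpha> - s)\<bar>)
        + \<beta> * (LINT x:cball 0 1|lborel. \<bar>x \<bullet> u - (\<alpha> + s)\<bar>)"
      using int by (simp add: I_def set_integral_add)
    also have "\<dots> \<le> \<beta> * (segment_bound (\<alpha> - s) * V) + \<beta> * (segment_bound (\<alpha> + s) * V)"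
      unfolding V_def using \<beta> by (intro add_mono mult_left_mono integral_ball_le u) auto
    finally have I: "I \<le> V * (\<beta> * Q)" by (simp add: Q_def algebra_simps)
    have \<beta>Q: "V * (\<beta> * Q) \<le> V * (1 + \<alpha>\<^sup>2 + \<beta>\<^sup>2)"
      using scaled_segment_bound_le(1)[OF s, of \<beta> \<alpha>] V unfolding Q_def by (intro mult_left_mono) auto
    have a: "V * (1 + \<alpha>\<^sup>2 + \<beta>\<^sup>2) \<le> V * (1 + (norm a)\<^sup>2 + \<beta>\<^sup>2)"
      using Cauchy_Schwarz_ineq[of a u] V u
      by (intro mult_left_mono) (auto simp: \<alpha>_def power2_norm_eq_inner norm_eq_1)
    have "a = 0 \<and> (b = e \<or> b = - e)" if "I = V * (1 + (norm a)\<^sup>2 + \<beta>\<^sup>2)"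
    proof -
      have "V * (\<beta> * Q) = V * (1 + \<alpha>\<^sup>2 + \<beta>\<^sup>2)" "V * (1 + \<alpha>\<^sup>2 + \<beta>\<^sup>2) = V * (1 + (norm a)\<^sup>2 + \<beta>\<^sup>2)"
        using I \<beta>Q a that by linarith+
      then have eqs: "\<beta> * Q = 1 + \<alpha>\<^sup>2 + \<beta>\<^sup>2" "\<alpha>\<^sup>2 = (norm a)\<^sup>2" using V by auto
      from scaled_segment_bound_le(2)[OF s, OF eqs(1)[unfolded Q_def]] \<beta>
      have *: "\<alpha> = 0" "\<bar>s\<bar> = 1" "\<beta> = 1" by auto
      have "(norm (u - e))\<^sup>2 = 2 - 2 * s" "(norm (u + e))\<^sup>2 = 2 + 2 * s"
        using u e by (simp_all add: power2_norm_eq_inner inner_simps s_def inner_commute norm_eq_1)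
      moreover have "s = 1 \<or> s = - 1" using *(2) by linarith
      ultimately have "u = e \<or> u = - e" by (auto simp: add_eq_0_iff2)
      with * eqs(2) show ?thesis by (simp add: b)
    qed
    with I \<beta>Q a show ?thesis unfolding \<beta>_def by linarith
  qed
  then show "I \<le> V * (1 + (norm a)\<^sup>2 + (norm b)\<^sup>2)"
    and "I = V * (1 + (norm a)\<^sup>2 + (norm b)\<^sup>2) \<Longrightarrow> a = 0 \<and> (b = e \<or> b = - e)"
    by blast+
qed

lemma min_squared_distance:
  fixes x a b :: "'a::real_inner"
  shows "min ((norm (x - (a + b)))\<^sup>2) ((norm (x - (a - b)))\<^sup>2)
    = (norm (x - a))\<^sup>2 + (norm b)\<^sup>2 - 2 * \<bar>b \<bullet> (x - a)\<bar>"
proof -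
  have "(norm (x - (a + b)))\<^sup>2 = (norm (x - a))\<^sup>2 + (norm b)\<^sup>2 - 2 * (b \<bullet> (x - a))"
    "(norm (x - (a - b)))\<^sup>2 = (norm (x - a))\<^sup>2 + (norm b)\<^sup>2 + 2 * (b \<bullet> (x - a))"
    by (simp_all add: power2_norm_eq_inner inner_simps inner_commute)
  then show ?thesis by (simp add: min_def abs_if)
qed

lemma inner_pos_of_mem_tangent_ball:
  fixes u :: "'a::real_inner"
  assumes u: "norm u = 1" and x: "x \<in> cball u 1" "x \<noteq> 0"
  shows "0 < x \<bullet> u"
proof -
  have "(norm (x - u))\<^sup>2 \<le> 1"
    using x(1) by (simp add: dist_norm norm_minus_commute power_le_one_iff)
  then have "(norm x)\<^sup>2 \<le> 2 * (x \<bullet> u)"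
    using u by (simp add: power2_norm_eq_inner inner_simps inner_commute norm_eq_1)
  moreover have "0 < (norm x)\<^sup>2" using x(2) by simp
  ultimately show ?thesis by linarith
qed

text \<open>The two balls lie on opposite sides of the plane \<open>x \<bullet> e = 0\<close> and meet only at the origin.\<close>

lemma tangent_balls_disjoint_AE:
  fixes e :: "'a::euclidean_space"
  assumes e: "norm e = 1"
  shows "AE x in lborel. \<not> (x \<in> cball e 1 \<and> x \<in> cball (- e) 1)"
  using AE_lborel_singleton[of "0::'a"]
proof eventually_elim
  case (elim x)
  then show ?case
    using inner_pos_of_mem_tangent_ball[of e x] inner_pos_of_mem_tangent_ball[of "- e" x] e
    by (auto simp del: mem_cball)
qed

lemma set_integral_tangent_balls:
  fixes f :: "'a::euclidean_space \<Rightarrow> real"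
  assumes e: "norm e = 1" and f: "continuous_on UNIV f"
  shows "(LINT x:cball e 1 \<union> cball (- e) 1|lborel. f x)
    = (LINT x:cball 0 1|lborel. f (e + x) + f (- e + x))"
proof -
  have shifted: "set_integrable lborel (cball 0 1) (\<lambda>x. f (p + x))" for p
    by (intro set_integrable_lborel_cball continuous_on_compose2[OF f] continuous_intros) auto
  have "(LINT x:cball e 1 \<union> cball (- e) 1|lborel. f x)
      = (LINT x:cball e 1|lborel. f x) + (LINT x:cball (- e) 1|lborel. f x)"
    by (rule set_integral_Un_AE[OF tangent_balls_disjoint_AE[OF e]])
       (auto intro: set_integrable_lborel_cball f)
  also have "\<dots> = (LINT x:cball 0 1|lborel. f (e + x)) + (LINT x:cball 0 1|lborel. f (- e + x))"
    using borel_measurable_continuous_onI[OF f] by (simp only: set_integral_cball_shift)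
  finally show ?thesis by (simp only: set_integral_add(2)[OF shifted shifted])
qed

text \<open>Summed over the two balls, the terms \<open>|x - a|\<^sup>2\<close> contribute
  \<open>2 |x|\<^sup>2 + 2 + 2 |a|\<^sup>2 - 4 x \<bullet> a\<close>, and the linear part integrates to zero. So \<open>E - 2 J\<close> is exactly twice
  the slack in the bound on the midplane distance.\<close>

lemma nearest_centre_error:
  fixes e c d :: "'a::euclidean_space"
  assumes e: "norm e = 1"
  defines "E \<equiv> (LINT x:cball e 1 \<union> cball (- e) 1|lborel. min ((norm (x - c))\<^sup>2) ((norm (x - d))\<^sup>2))"
    and "J \<equiv> (LINT x:cball (0::'a) 1|lborel. (norm x)\<^sup>2)"
  shows "2 * J \<le> E"
    and "E = 2 * J \<Longrightarrow> (c = e \<or> c = - e) \<and> d = - c"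
proof -
  define a b where "a = (c + d) /\<^sub>R 2" and "b = (c - d) /\<^sub>R 2"
  define V where "V = measure lborel (cball (0::'a) 1)"
  define I where "I = (LINT x:cball 0 1|lborel. \<bar>b \<bullet> (e + x - a)\<bar> + \<bar>b \<bullet> (- e + x - a)\<bar>)"
  have "2 *\<^sub>R (a + b) = 2 *\<^sub>R c" "2 *\<^sub>R (a - b) = 2 *\<^sub>R d"
    by (simp_all add: a_def b_def algebra_simps flip: scaleR_2)
  then have cd: "c = a + b" "d = a - b" by simp_all
  note I = midplane_distance_integral_le[OF e, where a = a and b = b, folded I_def V_def]
  have split: "min ((norm (e + x - c))\<^sup>2) ((norm (e + x - d))\<^sup>2)
        + min ((norm (- e + x - c))\<^sup>2) ((norm (- e + x - d))\<^sup>2)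
      = 2 * (norm x)\<^sup>2 - 4 * (x \<bullet> a) + 2 * (1 + (norm a)\<^sup>2 + (norm b)\<^sup>2)
        - 2 * (\<bar>b \<bullet> (e + x - a)\<bar> + \<bar>b \<bullet> (- e + x - a)\<bar>)" for x
  proof -
    have "(norm (e + x - a))\<^sup>2 + (norm (- e + x - a))\<^sup>2
        = 2 * (norm x)\<^sup>2 - 4 * (x \<bullet> a) + 2 * (1 + (norm a)\<^sup>2)"
      using e by (simp add: power2_norm_eq_inner inner_simps inner_commute norm_eq_1)
    then show ?thesis unfolding cd min_squared_distance by argo
  qed
  have int: "set_integrable lborel (cball 0 1) (\<lambda>x::'a. 2 * (norm x)\<^sup>2)"
    "set_integrable lborel (cball 0 1) (\<lambda>x. 4 * (x \<bullet> a))"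
    "set_integrable lborel (cball 0 1) (\<lambda>x::'a. 2 * (1 + (norm a)\<^sup>2 + (norm b)\<^sup>2))"
    "set_integrable lborel (cball 0 1) (\<lambda>x. 2 * (\<bar>b \<bullet> (e + x - a)\<bar> + \<bar>b \<bullet> (- e + x - a)\<bar>))"
    by (intro set_integrable_lborel_cball continuous_intros)+
  have "E = (LINT x:cball 0 1|lborel. 2 * (norm x)\<^sup>2 - 4 * (x \<bullet> a)
      + 2 * (1 + (norm a)\<^sup>2 + (norm b)\<^sup>2) - 2 * (\<bar>b \<bullet> (e + x - a)\<bar> + \<bar>b \<bullet> (- e + x - a)\<bar>))"
    unfolding E_def
    by (subst set_integral_tangent_balls[OF e]) (auto intro!: continuous_intros simp only: split)
  also have "\<dots> = 2 * J - 4 * (LINT x:cball 0 1|lborel. x \<bullet> a)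
      + 2 * (1 + (norm a)\<^sup>2 + (norm b)\<^sup>2) * V - 2 * I"
    unfolding set_integral_diff(2)[OF set_integral_add(1)[OF set_integral_diff(1)[OF int(1,2)] int(3)] int(4)]
      set_integral_add(2)[OF set_integral_diff(1)[OF int(1,2)] int(3)] set_integral_diff(2)[OF int(1,2)]
      set_integral_mult_right set_integral_const_unit_ball J_def V_def I_def
    by (simp only: mult.assoc)
  finally have E: "E = 2 * J + 2 * (V * (1 + (norm a)\<^sup>2 + (norm b)\<^sup>2) - I)"
    by (simp add: set_integral_unit_ball_inner algebra_simps)
  show "2 * J \<le> E" using E I(1) by simp
  assume "E = 2 * J"
  then have "a = 0 \<and> (b = e \<or> b = - e)" using E by (intro I(2)) simp
  then show "(c = e \<or> c = - e) \<and> d = - c" by (auto simp: cd)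
qed

section \<open>Partitions and their errors\<close>

text \<open>The open half-space \<open>x \<bullet> u > 0\<close> contains all of the ball around \<open>u\<close> but the origin and is disjoint
  from the ball around \<open>- u\<close>. Hence a part of the union that lies in one closed half-space, with its
  complement in the other, can differ from a ball only at the origin and in a null set.\<close>

lemma half_space_partition_is_ball:
  fixes u :: "'a::euclidean_space"
  assumes u: "norm u = 1" and A: "A \<in> sets borel" "A \<subseteq> cball u 1 \<union> cball (- u) 1"
    and pos: "AE x\<in>A in lborel. 0 \<le> x \<bullet> u"
    and neg: "AE x\<in>cball u 1 \<union> cball (- u) 1 - A in lborel. x \<bullet> u \<le> 0"
  shows "sym_diff A (cball u 1) \<in> null_sets lborel"
proof -
  have "AE x in lborel. x \<notin> sym_diff A (cball u 1)"
    using pos neg AE_lborel_singleton[of "0::'a"]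
  proof eventually_elim
    case (elim x)
    then show ?case
      using A(2) inner_pos_of_mem_tangent_ball[of u x] inner_pos_of_mem_tangent_ball[of "- u" x] u
      by (auto simp del: mem_cball)
  qed
  then show ?thesis
    using A(1) by (subst AE_iff_null_sets) auto
qed

text \<open>Replacing both squared distances by their minimum can only lower the error, and the previous bound
  applies to the minimum. In the case of equality the centres are \<open>c = \<plusminus> e\<close> and \<open>d = - c\<close>, and almost
  every point is nearest to the centre of its own part, so each part lies in a half-space.\<close>

lemma partition_error:
  fixes e c d :: "'a::euclidean_space"
  defines "S \<equiv> cball e 1 \<union> cball (- e) 1"
  assumes e: "norm e = 1" and A: "A \<in> sets borel" "A \<subseteq> S"
  defines "E \<equiv> (LINT x:A|lborel. (norm (x - c))\<^sup>2) + (LINT x:S - A|lborel. (norm (x - d))\<^sup>2)"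
    and "J \<equiv> (LINT x:cball (0::'a) 1|lborel. (norm x)\<^sup>2)"
  shows "2 * J \<le> E"
    and "E = 2 * J \<Longrightarrow> sym_diff A (cball e 1) \<in> null_sets lborel
      \<or> sym_diff A (cball (- e) 1) \<in> null_sets lborel"
proof -
  define m where "m x = min ((norm (x - c))\<^sup>2) ((norm (x - d))\<^sup>2)" for x
  have S: "compact S" "S \<in> sets borel" by (auto simp: S_def compact_Un)
  have cont: "continuous_on UNIV (\<lambda>x. (norm (x - p))\<^sup>2)" for p :: 'a
    by (intro continuous_intros)
  have cont_m: "continuous_on UNIV m"
    unfolding m_def[abs_def] by (intro continuous_intros)
  have int: "set_integrable lborel A f" "set_integrable lborel (S - A) f"
    if "continuous_on UNIV f" for f :: "'a \<Rightarrow> real"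
    using that S A by (auto intro!: set_integrable_lborel_compact[OF S(1)])
  have "(LINT x:A \<union> (S - A)|lborel. m x) = (LINT x:A|lborel. m x) + (LINT x:S - A|lborel. m x)"
    using int[OF cont_m] by (intro set_integral_Un) auto
  then have m: "(LINT x:S|lborel. m x) = (LINT x:A|lborel. m x) + (LINT x:S - A|lborel. m x)"
    using A(2) by (simp add: Un_absorb1)
  have 1: "(LINT x:A|lborel. m x) \<le> (LINT x:A|lborel. (norm (x - c))\<^sup>2)"
    and 2: "(LINT x:S - A|lborel. m x) \<le> (LINT x:S - A|lborel. (norm (x - d))\<^sup>2)"
    by (intro set_integral_mono int cont cont_m; simp add: m_def)+
  note nearest = nearest_centre_error[OF e, of c d, folded S_def J_def m_def]
  show "2 * J \<le> E" using nearest(1) 1 2 m by (simp add: E_def)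
  assume eq: "E = 2 * J"
  then have m2: "(LINT x:S|lborel. m x) = 2 * J" using nearest(1) 1 2 m by (simp add: E_def)
  from nearest(2)[OF this] have c: "norm c = 1" "c = e \<or> c = - e" and d: "d = - c"
    using e by auto
  have eqs: "(LINT x:A|lborel. m x) = (LINT x:A|lborel. (norm (x - c))\<^sup>2)"
    "(LINT x:S - A|lborel. m x) = (LINT x:S - A|lborel. (norm (x - d))\<^sup>2)"
    using eq m2 1 2 m by (simp_all add: E_def)
  have side: "m x = (norm (x - c))\<^sup>2 \<Longrightarrow> 0 \<le> x \<bullet> c"
    and side': "m x = (norm (x - d))\<^sup>2 \<Longrightarrow> x \<bullet> c \<le> 0" for x
  proof -
    have "(norm (x - d))\<^sup>2 - (norm (x - c))\<^sup>2 = 4 * (x \<bullet> c)"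
      by (simp add: d power2_norm_eq_inner inner_simps inner_commute)
    moreover have "m x \<le> (norm (x - c))\<^sup>2" "m x \<le> (norm (x - d))\<^sup>2"
      by (simp_all add: m_def)
    ultimately show "m x = (norm (x - c))\<^sup>2 \<Longrightarrow> 0 \<le> x \<bullet> c" "m x = (norm (x - d))\<^sup>2 \<Longrightarrow> x \<bullet> c \<le> 0"
      by linarith+
  qed
  have "AE x\<in>A in lborel. m x = (norm (x - c))\<^sup>2"
    using eqs(1) by (intro set_integral_eq_imp_AE_eq int cont cont_m) (auto simp: m_def)
  then have pos: "AE x\<in>A in lborel. 0 \<le> x \<bullet> c"
    by eventually_elim (simp add: side)
  have "AE x\<in>S - A in lborel. m x = (norm (x - d))\<^sup>2"
    using eqs(2) by (intro set_integral_eq_imp_AE_eq int cont cont_m) (auto simp: m_def)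
  then have neg: "AE x\<in>S - A in lborel. x \<bullet> c \<le> 0"
    by eventually_elim (simp add: side')
  have "S = cball c 1 \<union> cball (- c) 1" using c(2) by (auto simp: S_def)
  with half_space_partition_is_ball[OF c(1) A(1)] A(2) pos neg
  have "sym_diff A (cball c 1) \<in> null_sets lborel" by simp
  with c(2) show "sym_diff A (cball e 1) \<in> null_sets lborel
      \<or> sym_diff A (cball (- e) 1) \<in> null_sets lborel" by auto
qed

section \<open>Transfer to the mean squared error\<close>

text \<open>The overlap of the balls is a null set, so adding the two restrictions counts nothing twice.\<close>

lemma two_balls_measure_eq_density:
  fixes k :: "'n::finite"
  shows "two_balls_measure k = density lborel (indicator (two_balls k :: (real ^ 'n) set))"
proof (rule measure_eqI)
  show "sets (two_balls_measure k) = sets (density lborel (indicator (two_balls k :: (real ^ 'n) set)))"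
    by (simp add: sets_two_balls_measure)
  fix A :: "(real ^ 'n) set"
  assume "A \<in> sets (two_balls_measure k)"
  then have [measurable]: "A \<in> sets borel" by (simp add: sets_two_balls_measure)
  have [measurable]: "left_ball k \<in> sets (borel :: (real ^ 'n) measure)"
    "right_ball k \<in> sets (borel :: (real ^ 'n) measure)" by (simp_all add: left_ball_def right_ball_def)
  have "AE x in lborel. x \<notin> (left_ball k \<inter> A) \<inter> (right_ball k \<inter> A)"
    using tangent_balls_disjoint_AE[of "axis k 1 :: real ^ 'n"]
    by (auto simp: left_ball_def right_ball_def simp del: mem_cball)
  then have "(left_ball k \<inter> A) \<inter> (right_ball k \<inter> A) \<in> null_sets lborel"
    by (subst AE_iff_null_sets) auto
  then have "emeasure lborel (left_ball k \<inter> A) + emeasure lborel (right_ball k \<inter> A)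
      = emeasure lborel ((left_ball k \<inter> A) \<union> (right_ball k \<inter> A))"
    by (intro emeasure_Un'[symmetric]) auto
  then show "emeasure (two_balls_measure k) A
      = emeasure (density lborel (indicator (two_balls k))) A"
    by (simp add: emeasure_two_balls_measure emeasure_restricted two_balls_def Int_Un_distrib2)
qed

lemma cluster_error_two_balls:
  fixes k :: "'n::finite" and A :: "(real ^ 'n) set"
  assumes [measurable]: "A \<in> sets borel" and "A \<subseteq> two_balls k"
  shows "cluster_error (two_balls_measure k) A c = ennreal (LINT x:A|lborel. (norm (x - c))\<^sup>2)"
proof -
  have [measurable]: "two_balls k \<in> sets (borel :: (real ^ 'n) measure)"
    by (auto simp: two_balls_def left_ball_def right_ball_def)
  have "cluster_error (two_balls_measure k) A c = (\<integral>\<^sup>+x\<in>A. ennreal ((norm (x - c))\<^sup>2) \<partial>lborel)"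
    unfolding cluster_error_def two_balls_measure_eq_density
    using assms(2) by (subst nn_integral_density) (auto intro!: nn_integral_cong simp: indicator_def)
  also have "\<dots> = ennreal (LINT x:A|lborel. (norm (x - c))\<^sup>2)"
    using assms
    by (intro set_nn_integral_eq_set_integral set_integrable_lborel_compact[of "two_balls k"])
       (auto simp: two_balls_def left_ball_def right_ball_def compact_Un intro!: continuous_intros)
  finally show ?thesis .
qed

text \<open>Real-valued form of the error. That the infima are attained makes it possible to read off optimal
  centres in the case of equality.\<close>

lemma mean_squared_error_two_balls:
  fixes k :: "'n::finite" and A :: "(real ^ 'n) set"
  assumes A: "A \<in> sets borel" "A \<subseteq> two_balls k"
  defines "E \<equiv> \<lambda>c d. (LINT x:A|lborel. (norm (x - c))\<^sup>2) + (LINT x:two_balls k - A|lborel. (norm (x - d))\<^sup>2)"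
  shows "mean_squared_error (two_balls_measure k) (two_balls k) A \<le> ennreal (E c d)"
    and "\<exists>c d. mean_squared_error (two_balls_measure k) (two_balls k) A = ennreal (E c d)"
proof -
  have B: "two_balls k - A \<in> sets borel" "bounded (two_balls k - A)" "bounded A"
    using A(1) bounded_subset[OF _ A(2)]
    by (auto simp: two_balls_def left_ball_def right_ball_def intro: bounded_subset[OF _ Diff_subset])
  have nonneg: "0 \<le> (LINT x:M|lborel. (norm (x - c))\<^sup>2)" for M and c :: "real ^ 'n"
    by (auto simp: set_lebesgue_integral_def intro!: integral_nonneg_AE)
  have err: "cluster_error (two_balls_measure k) A c + cluster_error (two_balls_measure k) (two_balls k - A) d
      = ennreal (E c d)" for c d
    using A B by (simp add: cluster_error_two_balls E_def nonneg)
  show "mean_squared_error (two_balls_measure k) (two_balls k) A \<le> ennreal (E c d)"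
    unfolding mean_squared_error_def err[symmetric] by (intro add_mono INF_lower) auto
  show "\<exists>c d. mean_squared_error (two_balls_measure k) (two_balls k) A = ennreal (E c d)"
    using INF_cluster_error_attained[OF finite_two_balls_measure sets_two_balls_measure A(1) B(3)]
      INF_cluster_error_attained[OF finite_two_balls_measure sets_two_balls_measure B(1,2)]
    unfolding mean_squared_error_def err[symmetric] by metis
qed

text \<open>The value of the error for the partition into balls, with the two ball centres as cluster centres;
  it is the common value \<open>2 J\<close> of the lower bound.\<close>

lemma ball_partition_error:
  fixes e :: "'a::euclidean_space"
  defines "S \<equiv> cball e 1 \<union> cball (- e) 1"
  assumes e: "norm e = 1" and A: "A \<in> sets borel" "A \<subseteq> S"
    and null: "sym_diff A (cball e 1) \<in> null_sets lborel"
  shows "(LINT x:A|lborel. (norm (x - e))\<^sup>2) + (LINT x:S - A|lborel. (norm (x - (- e)))\<^sup>2)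
    = 2 * (LINT x:cball (0::'a) 1|lborel. (norm x)\<^sup>2)"
proof -
  have AE: "AE x in lborel. x \<in> A \<longleftrightarrow> x \<in> cball e 1"
    using AE_not_in[OF null] by eventually_elim auto
  have ball: "(LINT x:M|lborel. (norm (x - p))\<^sup>2) = (LINT x:cball (0::'a) 1|lborel. (norm x)\<^sup>2)"
    if [measurable]: "M \<in> sets borel" and "AE x in lborel. x \<in> M \<longleftrightarrow> x \<in> cball p 1" for M and p :: 'a
  proof -
    have [measurable]: "cball p 1 \<in> sets borel" by simp
    have "(LINT x:M|lborel. (norm (x - p))\<^sup>2) = (LINT x:cball p 1|lborel. (norm (x - p))\<^sup>2)"
      using that(2)
      by (intro set_integral_cong_set) (auto simp: set_borel_measurable_def simp del: mem_cball)
    then show ?thesis by (simp add: set_integral_cball_shift[of _ p])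
  qed
  have "AE x in lborel. x \<in> S - A \<longleftrightarrow> x \<in> cball (- e) 1"
    using AE tangent_balls_disjoint_AE[OF e] by eventually_elim (auto simp: S_def)
  with AE A(1) show ?thesis
    by (subst (1 2) ball) (auto simp: S_def)
qed

theorem theorem2:
  fixes k :: "'n::finite" and S1 :: "(real ^ 'n) set"
  assumes "CARD('n) \<ge> 3"
    and "S1 \<in> sets borel" and "S1 \<subseteq> two_balls k"
  shows "mean_squared_error (two_balls_measure k) (two_balls k) S1
           \<ge> mean_squared_error (two_balls_measure k) (two_balls k) (left_ball k)
       \<and> (mean_squared_error (two_balls_measure k) (two_balls k) S1
           = mean_squared_error (two_balls_measure k) (two_balls k) (left_ball k)
         \<longleftrightarrow> sym_diff S1 (left_ball k) \<in> null_sets lborel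
             \<or> sym_diff S1 (right_ball k) \<in> null_sets lborel)"
proof -
  define e :: "real ^ 'n" where "e = axis k 1"
  define J where "J = (LINT x:cball (0::real ^ 'n) 1|lborel. (norm x)\<^sup>2)"
  define E where "E A = mean_squared_error (two_balls_measure k) (two_balls k) A" for A :: "(real ^ 'n) set"
  have e: "norm e = 1" by (simp add: e_def)
  have balls: "left_ball k = cball (- e) 1" "right_ball k = cball e 1"
    "two_balls k = cball e 1 \<union> cball (- e) 1"
    by (auto simp: left_ball_def right_ball_def two_balls_def e_def)
  have J0: "0 \<le> J"
    by (auto simp: J_def set_lebesgue_integral_def intro!: integral_nonneg_AE)
  have lower: "ennreal (2 * J) \<le> E A"
    and equality: "E A = ennreal (2 * J) \<Longrightarrow>
      sym_diff A (left_ball k) \<in> null_sets lborel \<or> sym_diff A (right_ball k) \<in> null_sets lborel"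
    if A: "A \<in> sets borel" "A \<subseteq> two_balls k" for A
  proof -
    obtain c d where cd: "E A = ennreal ((LINT x:A|lborel. (norm (x - c))\<^sup>2)
        + (LINT x:two_balls k - A|lborel. (norm (x - d))\<^sup>2))" (is "_ = ennreal ?E")
      using mean_squared_error_two_balls(2)[OF A] unfolding E_def by blast
    note error = partition_error[OF e A[unfolded balls], of c d, folded balls J_def]
    show "ennreal (2 * J) \<le> E A"
      using error(1) by (simp add: cd ennreal_leI)
    assume "E A = ennreal (2 * J)"
    then have "?E = 2 * J" using error(1) J0 by (simp add: cd)
    from error(2)[OF this]
    show "sym_diff A (left_ball k) \<in> null_sets lborel \<or> sym_diff A (right_ball k) \<in> null_sets lborel"
      by blast
  qed
  have upper: "E A \<le> ennreal (2 * J)"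
    if A: "A \<in> sets borel" "A \<subseteq> two_balls k"
      and null: "sym_diff A (left_ball k) \<in> null_sets lborel \<or> sym_diff A (right_ball k) \<in> null_sets lborel" for A
  proof -
    \<comment> \<open>By symmetry the part close to either ball may be given the centre of that ball.\<close>
    obtain p where p: "p = e \<or> p = - e" "sym_diff A (cball p 1) \<in> null_sets lborel"
      using null unfolding balls by blast
    have p': "norm p = 1" "two_balls k = cball p 1 \<union> cball (- p) 1"
      using p(1) e by (auto simp: balls)
    show ?thesis
      using mean_squared_error_two_balls(1)[OF A, of p "- p"]
        ball_partition_error[OF p'(1) A(1) _ p(2)] A(2)
      by (simp add: E_def J_def p'(2))
  qed
  have "left_ball k \<in> sets (borel :: (real ^ 'n) measure)" "left_ball k \<subseteq> two_balls k"
    by (simp_all add: balls)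
  then have left: "E (left_ball k) = ennreal (2 * J)"
    using lower upper by (intro antisym) auto
  show ?thesis
    unfolding E_def[symmetric] left
    using lower[OF assms(2,3)] equality[OF assms(2,3)] upper[OF assms(2,3)] by (auto intro: antisym)
qed

end
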